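(* Let $\mathbb{D} \in \{\mathbb{R}, \mathbb{C}, \mathbb{H}\}$, $n \geq 1$, and let $f : (0,\infty) \to (0,\infty)$ be one of the following functions: (1) $f(x) = \sqrt{\frac{2x}{1+x}}$; (2) $f(x) = \sqrt{\frac{x-1}{\log(x)}}$ for $x \neq 1$, and $f(1) = 1$; (3) $f(x) = x^{\alpha/2}$ for some real $\alpha$ with $0 < \alpha < 1$. Let $A, B \in \mathscr{P}_n(\mathbb{D})$. If the alternative mean $A \hat{\sigma}_f B$ is linearizable, i.e. there exist $a, b \in \mathbb{R}$ such that $A \hat{\sigma}_f B = aA + bB$, then $AB = BA$ and $|\mathrm{Spec}(A^{-1} \sharp B)| \leq 2$.
   Context: For $\mathbb{D} \in \{\mathbb{R}, \mathbb{C}, \mathbb{H}\}$ (reals, complexes, quaternions), $\mathrm{Mat}_n(\mathbb{D})$ is the set of $n \times n$ matrices over $\mathbb{D}$, $X^* = \overline{X}^{t}$ is the conjugate transpose, and $\mathscr{P}_n(\mathbb{D})$ is the set of $X \in \mathrm{Mat}_n(\mathbb{D})$ with $X = X^*$ and $X > 0$ (positive definite). Every $X \in \mathscr{P}_n(\mathbb{D})$ can be written $X = U \,\mathrm{diag}(d_1, \ldots, d_n)\, U^*$ with $U U^* = \mathrm{Id}_n$ and real $d_i > 0$; the $d_i$ are the eigenvalues of $X$ (right eigenvalues when $\mathbb{D} = \mathbb{H}$), and $\mathrm{Spec}(X)$ is the set of eigenvalues, so $|\mathrm{Spec}(X)|$ is the number of distinct eigenvalues. For a function $g : (0,\infty)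 \to (0,\infty)$, $g(X) = U\,\mathrm{diag}(g(d_1), \ldots, g(d_n))\,U^*$ (functional calculus); in particular real powers $X^t$ are so defined. The geometric mean of $A, B \in \mathscr{P}_n(\mathbb{D})$ is $A \sharp B = A^{1/2}\left(A^{-1/2} B A^{-1/2}\right)^{1/2} A^{1/2}$; thus $A^{-1} \sharp B$ is the geometric mean of $A^{-1}$ and $B$. For a continuous function $f : (0,\infty) \to (0,\infty)$ with $f(1) = 1$, the alternative mean associated with $f$ is $$A \hat{\sigma}_f B = f\left(A^{-1} \sharp B\right) A\, f\left(A^{-1} \sharp B\right), \qquad A, B \in \mathscr{P}_n(\mathbb{D}).$$ *)

theory Defs
  imports "HOL-Analysis.Analysis"
begin

section \<open>Quaternions\<close>

datatype quat = Quat (qre: real) (qi: real) (qj: real) (qk: real)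

lemma quat_eq_iff: "x = y \<longleftrightarrow> qre x = qre y \<and> qi x = qi y \<and> qj x = qj y \<and> qk x = qk y"
  by (cases x; cases y) simp

instantiation quat :: ring_1
begin

definition "0 = Quat 0 0 0 0"
definition "1 = Quat 1 0 0 0"
definition "x + y = Quat (qre x + qre y) (qi x + qi y) (qj x + qj y) (qk x + qk y)"
definition "x - y = Quat (qre x - qre y) (qi x - qi y) (qj x - qj y) (qk x - qk y)"
definition "- x = Quat (- qre x) (- qi x) (- qj x) (- qk x)"
definition "x * y = Quat
  (qre x * qre y - qi x * qi y - qj x * qj y - qk x * qk y)
  (qre x * qi y + qi x * qre y + qj x * qk y - qk x * qj y)
  (qre x * qj y - qi x * qk y + qj x * qre y + qk x * qi y)
  (qre x * qk y + qi x * qj y - qj x * qi y + qk x * qre y)"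

lemmas quat_ring_defs =
  zero_quat_def one_quat_def plus_quat_def minus_quat_def uminus_quat_def times_quat_def

instance
  by standard (simp_all add: quat_eq_iff quat_ring_defs algebra_simps)

end

instantiation quat :: real_div_algebra
begin

definition "r *\<^sub>R x = Quat (r * qre x) (r * qi x) (r * qj x) (r * qk x)"
definition "inverse x =
  (let s = (qre x)\<^sup>2 + (qi x)\<^sup>2 + (qj x)\<^sup>2 + (qk x)\<^sup>2
   in Quat (qre x / s) (- qi x / s) (- qj x / s) (- qk x / s))"
definition "x div (y::quat) = x * inverse y"

lemma quat_sum_squares_pos:
  "x \<noteq> 0 \<Longrightarrow> (qre x)\<^sup>2 + (qi x)\<^sup>2 + (qj x)\<^sup>2 + (qk x)\<^sup>2 > 0"
  by (auto simp: quat_eq_iff zero_quat_def add_pos_nonneg add_nonneg_pos)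

instance
proof
  fix x y :: quat and a b :: real
  show "a *\<^sub>R (x + y) = a *\<^sub>R x + a *\<^sub>R y"
       "(a + b) *\<^sub>R x = a *\<^sub>R x + b *\<^sub>R x"
       "a *\<^sub>R b *\<^sub>R x = (a * b) *\<^sub>R x" "1 *\<^sub>R x = x"
       "a *\<^sub>R x * y = a *\<^sub>R (x * y)" "x * a *\<^sub>R y = a *\<^sub>R (x * y)"
    by (simp_all add: quat_eq_iff scaleR_quat_def quat_ring_defs algebra_simps)
  show "inverse x * x = 1" "x * inverse x = 1" if "x \<noteq> 0"
    using quat_sum_squares_pos[OF that]
    by (simp_all add: quat_eq_iff inverse_quat_def Let_def quat_ring_defs
        add_divide_distrib[symmetric] diff_divide_distrib[symmetric] power2_eq_square mult.commute)
  show "inverse (0::quat) = 0"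
    by (simp add: inverse_quat_def quat_ring_defs)
  show "x div y = x * inverse y"
    by (simp add: divide_quat_def)
qed

end


section \<open>Real division algebras with conjugation\<close>

class star_div_algebra = real_div_algebra +
  fixes bar :: "'a \<Rightarrow> 'a"
  assumes bar_add: "bar (x + y) = bar x + bar y"
    and bar_mult: "bar (x * y) = bar y * bar x"
    and bar_bar: "bar (bar x) = x"
    and bar_scaleR: "bar (r *\<^sub>R x) = r *\<^sub>R bar x"
    and bar_times_self: "x \<noteq> 0 \<Longrightarrow> \<exists>r>0. bar x * x = r *\<^sub>R 1"

instantiation real :: star_div_algebra
begin
definition bar_real :: "real \<Rightarrow> real" where "bar_real x = x"
instance
proof
  show "\<exists>r>0. bar x * x = r *\<^sub>R 1" if "x \<noteq> 0" for x :: real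
    using that by (intro exI[of _ "x * x"]) (auto simp: bar_real_def zero_less_mult_iff)
qed (simp_all add: bar_real_def)
end

instantiation complex :: star_div_algebra
begin
definition bar_complex :: "complex \<Rightarrow> complex" where "bar_complex x = cnj x"
instance
proof
  show "\<exists>r>0. bar x * x = r *\<^sub>R 1" if "x \<noteq> 0" for x :: complex
    using that by (intro exI[of _ "(Re x)\<^sup>2 + (Im x)\<^sup>2"])
      (auto simp: bar_complex_def complex_eq_iff power2_eq_square sum_squares_gt_zero_iff)
qed (simp_all add: bar_complex_def)
end

instantiation quat :: star_div_algebra
begin
definition bar_quat :: "quat \<Rightarrow> quat" where
  "bar_quat x = Quat (qre x) (- qi x) (- qj x) (- qk x)"
instance
proof
  fix x y :: quat and r :: real
  show "bar (x + y) = bar x + bar y" "bar (x * y) = bar y * bar x"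
       "bar (bar x) = x" "bar (r *\<^sub>R x) = r *\<^sub>R bar x"
    by (simp_all add: quat_eq_iff bar_quat_def scaleR_quat_def quat_ring_defs algebra_simps)
  show "\<exists>r>0. bar x * x = r *\<^sub>R 1" if "x \<noteq> 0"
    using quat_sum_squares_pos[OF that]
    by (intro exI[of _ "(qre x)\<^sup>2 + (qi x)\<^sup>2 + (qj x)\<^sup>2 + (qk x)\<^sup>2"])
      (simp add: quat_eq_iff bar_quat_def scaleR_quat_def quat_ring_defs
        power2_eq_square)
qed
end


section \<open>Positive definite matrices and functional calculus\<close>

definition conj_transpose :: "'a::star_div_algebra ^ 'n ^ 'm \<Rightarrow> 'a ^ 'm ^ 'n" where
  "conj_transpose X = (\<chi> i j. bar (X $ j $ i))"

definition posdef :: "('a::star_div_algebra ^ 'n ^ 'n) set" where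
  "posdef = {X. conj_transpose X = X \<and>
     (\<forall>v. v \<noteq> 0 \<longrightarrow>
        (\<exists>r::real. r > 0 \<and> (\<Sum>i\<in>UNIV. \<Sum>j\<in>UNIV. bar (v $ i) * X $ i $ j * v $ j) = of_real r))}"

definition real_diag :: "('n \<Rightarrow> real) \<Rightarrow> 'a::star_div_algebra ^ 'n ^ 'n" where
  "real_diag d = (\<chi> i j. if i = j then of_real (d i) else 0)"

text \<open>The value does not depend on the diagonalization \<open>(U, d)\<close>, hence the definite description.\<close>

definition fun_calc ::
  "(real \<Rightarrow> real) \<Rightarrow> 'a::star_div_algebra ^ 'n ^ 'n \<Rightarrow> 'a ^ 'n ^ 'n" where
  "fun_calc g X = (THE Y. \<exists>(U :: 'a ^ 'n ^ 'n) d. U ** conj_transpose U = mat 1 \<and> (\<forall>i. d i > 0) \<and>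
      X = U ** real_diag d ** conj_transpose U \<and>
      Y = U ** real_diag (\<lambda>i. g (d i)) ** conj_transpose U)"

definition mat_powr :: "'a::star_div_algebra ^ 'n ^ 'n \<Rightarrow> real \<Rightarrow> 'a ^ 'n ^ 'n" where
  "mat_powr X t = fun_calc (\<lambda>x. x powr t) X"

text \<open>Right eigenvalues, which are the ordinary eigenvalues over commutative \<open>'a\<close>.\<close>

definition Spec :: "'a::star_div_algebra ^ 'n ^ 'n \<Rightarrow> 'a set" where
  "Spec X = {l. \<exists>v. v \<noteq> 0 \<and> X *v v = (\<chi> i. v $ i * l)}"


section \<open>Means\<close>

definition geo_mean ::
  "'a::star_div_algebra ^ 'n ^ 'n \<Rightarrow> 'a ^ 'n ^ 'n \<Rightarrow> 'a ^ 'n ^ 'n" where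
  "geo_mean A B =
     mat_powr A (1/2) **
     mat_powr (mat_powr A (-1/2) ** B ** mat_powr A (-1/2)) (1/2) **
     mat_powr A (1/2)"

definition alt_mean ::
  "(real \<Rightarrow> real) \<Rightarrow> 'a::star_div_algebra ^ 'n ^ 'n \<Rightarrow> 'a ^ 'n ^ 'n \<Rightarrow> 'a ^ 'n ^ 'n" where
  "alt_mean f A B =
     fun_calc f (geo_mean (matrix_inv A) B) ** A ** fun_calc f (geo_mean (matrix_inv A) B)"

definition alt_mean_linearizable ::
  "(real \<Rightarrow> real) \<Rightarrow> 'a::star_div_algebra ^ 'n ^ 'n \<Rightarrow> 'a ^ 'n ^ 'n \<Rightarrow> bool" where
  "alt_mean_linearizable f A B \<longleftrightarrow> (\<exists>a b :: real. alt_mean f A B = a *\<^sub>R A + b *\<^sub>R B)"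

end

theory Submission imports Defs begin

text \<open>
  Write \<open>C = A\<^sup>-\<^sup>1 \<sharp> B\<close>. It solves the Riccati equation \<open>C A C = B\<close> (\<open>geo_mean_riccati\<close>), so that
  linearizability reads \<open>f(C) A f(C) = a A + b C A C\<close>, an equation in \<open>A\<close> and \<open>C\<close> alone. In an orthonormal
  eigenbasis of \<open>C\<close>, with eigenvalues \<open>c\<^sub>i\<close> and with \<open>A'\<close> the matrix of \<open>A\<close>, the entries give
  \<open>f(c\<^sub>i) f(c\<^sub>j) A'\<^sub>i\<^sub>j = (a + b c\<^sub>i c\<^sub>j) A'\<^sub>i\<^sub>j\<close>. The diagonal entries of \<open>A'\<close> are positive, hence
  \<open>f(c\<^sub>i)\<^sup>2 = a + b c\<^sub>i\<^sup>2\<close> for every \<open>i\<close>. If an off-diagonal entry \<open>A'\<^sub>i\<^sub>j\<close> does not vanish, squaring its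
  equation and comparing with the two diagonal ones leaves \<open>a b (c\<^sub>i - c\<^sub>j)\<^sup>2 = 0\<close>.

  The function enters only through \<open>g(x) = f(\<surd>x)\<^sup>2\<close>, which for all three families is positive and
  strictly concave on the positive half-line (\<open>mean_functions_chord_concave\<close>). Its graph meets a
  line at most twice, so at most two distinct \<open>c\<^sub>i\<close> occur; it meets a line through the origin or a
  horizontal line at most once, so \<open>a = 0\<close> or \<open>b = 0\<close> also forces \<open>c\<^sub>i = c\<^sub>j\<close>. Thus \<open>A'\<close> is block diagonal
  along the eigenspaces of \<open>C\<close>, that is, \<open>A\<close> commutes with \<open>C\<close>, and therefore with \<open>B = C A C\<close>
  (\<open>linearizable_commute_spec\<close>).

  The linear algebra is done once for the real, complex and quaternionic case, in a class of division
  algebras whose norm is Euclidean. Its core is the spectral theorem \<open>hermitian_diagonalization\<close>: a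
  Hermitian matrix is a real-linear self-adjoint operator, an eigenvector is a maximum of the Rayleigh
  quotient on the unit sphere, and one continues in the orthogonal complement of the eigenvectors
  already found. It makes the functional calculus, a definite description, computable
  (\<open>fun_calc_diagonalized\<close>).
\<close>


section \<open>Strictly concave functions on the positive half-line\<close>

text \<open>Strict concavity on the positive half-line, as the strict decrease of chord slopes with the
  denominators cleared.\<close>

definition chord_concave :: "(real \<Rightarrow> real) \<Rightarrow> bool" where
  "chord_concave g \<longleftrightarrow>
     (\<forall>x y z. 0 < x \<longrightarrow> x < y \<longrightarrow> y < z \<longrightarrow> (y - x) * (g z - g y) < (z - y) * (g y - g x))"

lemma chord_concaveD:
  "chord_concave g \<Longrightarrow> 0 < x \<Longrightarrow> x < y \<Longrightarrow> y < z \<Longrightarrow> (y - x) * (g z - g y) < (z - y) * (g y - g x)"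
  by (auto simp: chord_concave_def)

lemma chord_concave_affine_card:
  assumes g: "chord_concave g" and S: "\<And>x. x \<in> S \<Longrightarrow> 0 < x \<and> g x = a + b * x" and fin: "finite S"
  shows "card S \<le> 2"
proof (rule ccontr)
  assume "\<not> card S \<le> 2"
  then have "3 \<le> card S" by simp
  then obtain T where T: "T \<subseteq> S" "card T = 3" by (meson obtain_subset_with_card_n)
  then obtain x y z where xyz: "T = {x, y, z}" "x \<noteq> y" "y \<noteq> z" "x \<noteq> z"
    by (auto simp: card_3_iff)
  have no: "False" if "p < q" "q < r" "{p, q, r} \<subseteq> S" for p q r
  proof -
    have "(q - p) * (g r - g q) < (r - q) * (g q - g p)"
      using that S by (intro chord_concaveD[OF g]) auto
    moreover have "g p = a + b * p" "g q = a + b * q" "g r = a + b * r" using S that by auto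
    ultimately show False by (simp add: algebra_simps)
  qed
  have "{x, y, z} \<subseteq> S" using T xyz by simp
  then show False
    using no[of x y z] no[of x z y] no[of y x z] no[of y z x] no[of z x y] no[of z y x] xyz
    by (metis insert_commute linorder_neqE)
qed

text \<open>A positive concave function on the half-line lies on or above the ray from the origin through any
  of its points, to the left of that point. Two points on the same ray would pull it strictly below.\<close>

lemma chord_concave_eq_linear:
  assumes g: "chord_concave g" and pos: "\<And>x. 0 < x \<Longrightarrow> 0 < g x"
    and "0 < x" "x < y" "g x = b * x" "g y = b * y"
  shows False
proof -
  define e where "e = x / 2"
  have e: "0 < e" "e < x" using assms by (auto simp: e_def)
  have "(x - e) * (g y - g x) < (y - x) * (g x - g e)"
    using chord_concaveD[OF g, of e x y] e assms by simp
  then have "(y - x) * g e < (y - x) * (b * e)" using assms by (simp add: algebra_simps)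
  then have less: "g e < b * e" using assms by simp
  have b: "0 < b" using pos[of x] assms by (simp add: zero_less_mult_iff)
  define d where "d = (b * e - g e) / b"
  have d: "0 < d" using b less by (simp add: d_def)
  \<comment> \<open>The line through \<open>(e, g e)\<close> and \<open>(x, b x)\<close> is too steep; already the ray of slope \<open>b\<close> drawn backwards
    from \<open>(e, g e)\<close> reaches zero at the positive abscissa \<open>d\<close>.\<close>
  have eb: "(e - d) * b = g e" using b by (simp add: d_def field_simps)
  have "0 < (e - d) * b" using eb pos[of e] e by simp
  then have de: "d < e" using b by (simp add: zero_less_mult_iff)
  have "(e - d) * (g x - g e) < (x - e) * (g e - g d)"
    using chord_concaveD[OF g, of d e x] d de e by simp
  then have "(e - d) * (b * x) + (x - e) * g d < (x - d) * g e"
    using assms by (simp add: algebra_simps)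
  moreover have "0 < (x - e) * g d" using e d pos by simp
  moreover have "(e - d) * (b * x) = x * g e" by (simp only: eb[symmetric] mult_ac)
  moreover have "0 < d * g e" using d pos e by simp
  ultimately show False by (simp only: left_diff_distrib)
qed

text \<open>Beyond a second point on the same level the function decreases at a definite rate, so it would
  become negative.\<close>

lemma chord_concave_eq_const:
  assumes g: "chord_concave g" and pos: "\<And>x. 0 < x \<Longrightarrow> 0 < g x"
    and "0 < x" "x < y" "g x = a" "g y = a"
  shows False
proof -
  define z where "z = y + 1"
  have z: "y < z" by (simp add: z_def)
  have "(y - x) * (g z - g y) < 0"
    using chord_concaveD[OF g, of x y z] z assms by simp
  then have less: "g z < a" using assms by (simp add: mult_less_0_iff)
  define w where "w = z + a * (z - y) / (a - g z)"
  \<comment> \<open>At \<open>w\<close> the line through \<open>(y, a)\<close> and \<open>(z, g z)\<close> has the value \<open>g z - a < 0\<close>.\<close>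
  have a: "0 < a" using pos[of x] assms by simp
  have w: "z < w" using a less z by (simp add: w_def)
  have "(z - y) * (g w - g z) < (w - z) * (g z - g y)"
    using chord_concaveD[OF g, of y z w] w z assms by simp
  moreover have "(w - z) * (g z - g y) = - a * (z - y)"
    using less assms(6) by (simp add: w_def field_simps)
  ultimately have "(z - y) * (g w - g z + a) < 0" by (simp add: algebra_simps)
  moreover have "0 < (z - y) * (g w - g z + a)"
    using pos[of w] w z assms(3,4) less by (intro mult_pos_pos) linarith+
  ultimately show False by simp
qed

lemma chord_concave_powr:
  assumes "0 < p" "p < 1"
  shows "chord_concave (\<lambda>x. x powr p)"
  unfolding chord_concave_def
proof (intro allI impI)
  fix x y z :: real assume xyz: "0 < x" "x < y" "y < z"
  have D: "((\<lambda>x. x powr p) has_real_derivative p * t powr (p - 1)) (at t)" if "0 < t" for t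
    using that by (auto intro!: derivative_eq_intros)
  obtain s where s: "x < s" "s < y" "y powr p - x powr p = (y - x) * (p * s powr (p - 1))"
    using MVT2[OF xyz(2), of "\<lambda>x. x powr p" "\<lambda>t. p * t powr (p - 1)"] D xyz by auto
  obtain t where t: "y < t" "t < z" "z powr p - y powr p = (z - y) * (p * t powr (p - 1))"
    using MVT2[OF xyz(3), of "\<lambda>x. x powr p" "\<lambda>t. p * t powr (p - 1)"] D xyz by auto
  have "t powr (p - 1) < s powr (p - 1)"
    using s t xyz assms by (intro powr_less_mono2_neg) auto
  then have "(y - x) * (z - y) * p * t powr (p - 1) < (y - x) * (z - y) * p * s powr (p - 1)"
    using xyz assms by (intro mult_strict_left_mono) auto
  then show "(y - x) * (z powr p - y powr p) < (z - y) * (y powr p - x powr p)"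
    unfolding s(3) t(3) by (simp add: mult_ac)
qed

lemma chord_concave_harmonic: "chord_concave (\<lambda>x. 2 * sqrt x / (1 + sqrt x))"
  unfolding chord_concave_def
proof (intro allI impI)
  fix x y z :: real assume xyz: "0 < x" "x < y" "y < z"
  define p q r where "p = sqrt x" and "q = sqrt y" and "r = sqrt z"
  have pqr: "0 < p" "p < q" "q < r" and sq: "x = p\<^sup>2" "y = q\<^sup>2" "z = r\<^sup>2"
    using xyz by (auto simp: p_def q_def r_def)
  define K where "K = 2 * (q - p) * (r - q)"
  have K: "0 < K" using pqr by (simp add: K_def)
  have ne: "1 + p \<noteq> 0" "1 + q \<noteq> 0" "1 + r \<noteq> 0" using pqr by auto
  have diff: "2 * t / (1 + t) - 2 * s / (1 + s) = 2 * (t - s) / ((1 + t) * (1 + s))"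
    if "1 + t \<noteq> 0" "1 + s \<noteq> 0" for s t :: real
    using that by (simp add: field_simps)
  have "(q + p) * (1 + p) < (r + q) * (1 + r)"
    using pqr by (intro mult_strict_mono) auto
  then have "(q + p) / (1 + r) < (r + q) / (1 + p)"
    using pqr by (simp add: divide_less_eq less_divide_eq mult.commute)
  then have "K / (1 + q) * ((q + p) / (1 + r)) < K / (1 + q) * ((r + q) / (1 + p))"
    using K pqr by (intro mult_strict_left_mono) auto
  moreover have "(q\<^sup>2 - p\<^sup>2) * (2 * r / (1 + r) - 2 * q / (1 + q)) = K / (1 + q) * ((q + p) / (1 + r))"
    unfolding diff[OF ne(3,2)] K_def power2_eq_square square_diff_square_factored
    by (simp only: times_divide_eq_right times_divide_eq_left divide_divide_eq_left mult_ac)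
  moreover have "(r\<^sup>2 - q\<^sup>2) * (2 * q / (1 + q) - 2 * p / (1 + p)) = K / (1 + q) * ((r + q) / (1 + p))"
    unfolding diff[OF ne(2,1)] K_def power2_eq_square square_diff_square_factored
    by (simp only: times_divide_eq_right times_divide_eq_left divide_divide_eq_left mult_ac)
  ultimately show "(y - x) * (2 * sqrt z / (1 + sqrt z) - 2 * sqrt y / (1 + sqrt y))
      < (z - y) * (2 * sqrt y / (1 + sqrt y) - 2 * sqrt x / (1 + sqrt x))"
    by (simp only: p_def[symmetric] q_def[symmetric] r_def[symmetric] sq[symmetric])
qed

text \<open>This function is the average of \<open>x powr (s / 2)\<close> over \<open>s \<in> [0, 1]\<close>, hence strictly concave because each
  of these powers is. Instead of integrating, the mean value theorem is applied to an antiderivative in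
  \<open>s\<close> of the defect of concavity.\<close>

lemma chord_concave_logarithmic:
  "chord_concave (\<lambda>x. if x = 1 then 1 else (sqrt x - 1) / ln (sqrt x))" (is "chord_concave ?g")
  unfolding chord_concave_def
proof (intro allI impI)
  fix x y z :: real assume xyz: "0 < x" "x < y" "y < z"
  define L where "L t s = (if t = 1 then s else t powr (s / 2) / (ln t / 2))" for t s :: real
  have D: "(L t has_real_derivative t powr (s / 2)) (at s)" if "0 < t" for t s
  proof (cases "t = 1")
    case True
    then show ?thesis by (auto simp: L_def[abs_def])
  next
    case False
    then have "ln t \<noteq> 0" using that by simp
    then show ?thesis using that False unfolding L_def[abs_def]
      by (auto intro!: derivative_eq_intros)
  qed
  have L01: "L t 1 - L t 0 = ?g t" if "0 < t" for t
    using that by (auto simp: L_def ln_sqrt powr_half_sqrt diff_divide_distrib)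
  define F where "F s = (z - y) * (L y s - L x s) - (y - x) * (L z s - L y s)" for s
  have DF: "(F has_real_derivative (z - y) * (y powr (s / 2) - x powr (s / 2))
      - (y - x) * (z powr (s / 2) - y powr (s / 2))) (at s)" for s
    unfolding F_def[abs_def] using xyz
    by (intro derivative_intros DERIV_cmult D) auto
  obtain s :: real where s: "0 < s" "s < 1" "F 1 - F 0 = (1 - 0) *
      ((z - y) * (y powr (s / 2) - x powr (s / 2)) - (y - x) * (z powr (s / 2) - y powr (s / 2)))"
    using MVT2[of 0 1 F, OF _ DF] by auto
  have "0 < F 1 - F 0"
    using chord_concaveD[OF chord_concave_powr[of "s / 2"] xyz] s by simp
  moreover have "F 1 - F 0 = (z - y) * ((L y 1 - L y 0) - (L x 1 - L x 0))
      - (y - x) * ((L z 1 - L z 0) - (L y 1 - L y 0))"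
    by (simp add: F_def algebra_simps)
  ultimately show "(y - x) * (?g z - ?g y) < (z - y) * (?g y - ?g x)"
    using xyz by (simp only: L01)
qed

section \<open>The three division algebras as Euclidean spaces\<close>

instantiation quat :: real_inner
begin

definition inner_quat :: "quat \<Rightarrow> quat \<Rightarrow> real" where
  "inner_quat x y = qre x * qre y + qi x * qi y + qj x * qj y + qk x * qk y"
definition norm_quat :: "quat \<Rightarrow> real" where "norm_quat x = sqrt (x \<bullet> x)"
definition sgn_quat :: "quat \<Rightarrow> quat" where "sgn_quat x = x /\<^sub>R norm x"
definition dist_quat :: "quat \<Rightarrow> quat \<Rightarrow> real" where "dist_quat x y = norm (x - y)"
definition uniformity_quat :: "(quat \<times> quat) filter" where
  "uniformity_quat = (INF e\<in>{0<..}. principal {(x, y). dist x y < e})"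
definition open_quat :: "quat set \<Rightarrow> bool" where
  "open_quat U \<longleftrightarrow> (\<forall>x\<in>U. eventually (\<lambda>(x', y). x' = x \<longrightarrow> y \<in> U) uniformity)"

instance
proof
  fix x y z :: quat and r :: real
  show "x \<bullet> y = y \<bullet> x" "(x + y) \<bullet> z = x \<bullet> z + y \<bullet> z" "(r *\<^sub>R x) \<bullet> y = r * (x \<bullet> y)"
    by (simp_all add: inner_quat_def scaleR_quat_def plus_quat_def algebra_simps)
  show "0 \<le> x \<bullet> x" by (simp add: inner_quat_def)
  show "x \<bullet> x = 0 \<longleftrightarrow> x = 0"
  proof (cases "x = 0")
    case False
    then show ?thesis
      using quat_sum_squares_pos[of x] by (simp add: inner_quat_def power2_eq_square)
  qed (simp add: inner_quat_def zero_quat_def)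
qed (simp_all only: norm_quat_def sgn_quat_def dist_quat_def uniformity_quat_def open_quat_def)

end

instantiation quat :: euclidean_space
begin

definition Basis_quat :: "quat set" where
  "Basis_quat = {Quat 1 0 0 0, Quat 0 1 0 0, Quat 0 0 1 0, Quat 0 0 0 1}"

instance
proof
  show "(Basis :: quat set) \<noteq> {}" "finite (Basis :: quat set)"
    by (simp_all add: Basis_quat_def)
  show "u \<bullet> v = (if u = v then 1 else 0)" if "u \<in> Basis" "v \<in> Basis" for u v :: quat
    using that unfolding Basis_quat_def by (elim insertE emptyE) (simp_all add: inner_quat_def)
  show "(\<forall>u\<in>Basis. x \<bullet> u = 0) \<longleftrightarrow> x = 0" for x :: quat
    unfolding quat_eq_iff[of x 0] by (simp add: Basis_quat_def inner_quat_def zero_quat_def)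
qed

end

text \<open>The real inner product supplies compactness and dimension counting, both of which would be
  missing in an abstract division algebra; the axiom makes it the real part of \<open>bar x * y\<close>.\<close>

class star_euclidean = star_div_algebra + euclidean_space +
  assumes bar_self_norm: "bar x * x = (norm x)\<^sup>2 *\<^sub>R 1"

instance real :: star_euclidean
  by standard (simp add: bar_real_def power2_eq_square)

instance complex :: star_euclidean
proof
  show "bar x * x = (norm x)\<^sup>2 *\<^sub>R 1" for x :: complex
    using complex_norm_square[of x] unfolding bar_complex_def of_real_def[symmetric]
    by (simp only: mult.commute[of x])
qed

instance quat :: star_euclidean
proof
  show "bar x * x = (norm x)\<^sup>2 *\<^sub>R 1" for x :: quat
    unfolding power2_norm_eq_inner scaleR_quat_def one_quat_def
    by (simp add: inner_quat_def bar_quat_def times_quat_def)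
qed

lemma bar_0 [simp]: "bar (0::'a::star_div_algebra) = 0"
  using bar_scaleR[of 0 "0::'a"] by simp

lemma bar_1 [simp]: "bar (1::'a::star_div_algebra) = 1"
  by (metis bar_bar bar_mult mult.right_neutral)

lemma bar_of_real [simp]: "bar (of_real r :: 'a::star_div_algebra) = of_real r"
  by (simp add: of_real_def bar_scaleR)

lemma bar_sum: "bar (sum f S) = (\<Sum>x\<in>S. bar (f x :: 'a::star_div_algebra))"
  by (induction S rule: infinite_finite_induct) (simp_all add: bar_add)

lemma bar_polarization: "bar x * y + bar y * x = of_real (2 * (x \<bullet> y))"
  for x y :: "'a::star_euclidean"
proof -
  have "(norm (x + y))\<^sup>2 *\<^sub>R (1::'a) = bar (x + y) * (x + y)"
    by (simp add: bar_self_norm)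
  also have "\<dots> = (norm x)\<^sup>2 *\<^sub>R 1 + (norm y)\<^sup>2 *\<^sub>R 1 + (bar x * y + bar y * x)"
    by (simp add: bar_add algebra_simps flip: bar_self_norm)
  finally have "bar x * y + bar y * x = ((norm (x + y))\<^sup>2 - (norm x)\<^sup>2 - (norm y)\<^sup>2) *\<^sub>R 1"
    by (simp add: algebra_simps)
  also have "(norm (x + y))\<^sup>2 - (norm x)\<^sup>2 - (norm y)\<^sup>2 = 2 * (x \<bullet> y)"
    by (simp add: power2_norm_eq_inner inner_add inner_commute)
  finally show ?thesis by (simp only: of_real_def)
qed


section \<open>The spectral theorem\<close>

definition hprod :: "'a::star_div_algebra ^ 'n \<Rightarrow> 'a ^ 'n \<Rightarrow> 'a" where
  "hprod v w = (\<Sum>i\<in>UNIV. bar (v $ i) * w $ i)"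

lemma hprod_add_right: "hprod v (w + w') = hprod v w + hprod v w'"
  by (simp add: hprod_def distrib_left sum.distrib)

lemma hprod_scaleR_right: "hprod v (r *\<^sub>R w) = r *\<^sub>R hprod v w"
  by (simp add: hprod_def scaleR_sum_right)

lemma hprod_scaleR_left: "hprod (r *\<^sub>R v) w = r *\<^sub>R hprod v w"
  by (simp add: hprod_def scaleR_sum_right bar_scaleR)

lemma bar_hprod: "bar (hprod v w) = hprod w v"
  by (simp add: hprod_def bar_sum bar_mult bar_bar)

lemma hprod_polarization: "hprod v w + hprod w v = of_real (2 * (v \<bullet> w))"
  for v w :: "'a::star_euclidean ^ 'n"
  by (simp only: hprod_def sum.distrib[symmetric] bar_polarization inner_vec_def
      of_real_sum sum_distrib_left)

lemma hprod_conj_transpose: "hprod v (X *v w) = hprod (conj_transpose X *v v) w"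
  for v w :: "'a::star_div_algebra ^ 'n"
  by (simp add: hprod_def matrix_vector_mult_def conj_transpose_def sum_distrib_left
      sum_distrib_right bar_sum bar_mult bar_bar mult.assoc)
    (rule sum.swap)

lemma hprod_symmetric_real:
  fixes v w :: "'a::star_euclidean ^ 'n"
  assumes "hprod w v = hprod v w"
  shows "hprod v w = of_real (v \<bullet> w)"
proof -
  have "2 *\<^sub>R hprod v w = 2 *\<^sub>R of_real (v \<bullet> w)"
    using hprod_polarization[of v w] unfolding assms scaleR_2 by (simp only: mult_2 of_real_add)
  then show ?thesis by (simp only: scaleR_cancel_left) simp
qed

lemma hprod_self: "hprod v v = of_real ((norm v)\<^sup>2)" for v :: "'a::star_euclidean ^ 'n"
  by (simp only: power2_norm_eq_inner hprod_symmetric_real[OF refl])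

lemma inner_conj_transpose: "v \<bullet> (X *v w) = (conj_transpose X *v v) \<bullet> w"
  for v w :: "'a::star_euclidean ^ 'n"
proof -
  have "hprod v (X *v w) + hprod (X *v w) v
      = hprod (conj_transpose X *v v) w + hprod w (conj_transpose X *v v)"
    by (metis bar_hprod hprod_conj_transpose)
  then have "of_real (2 * (v \<bullet> (X *v w))) = (of_real (2 * ((conj_transpose X *v v) \<bullet> w)) :: 'a)"
    by (simp only: hprod_polarization)
  then show ?thesis by (simp only: of_real_eq_iff mult_cancel_left) simp
qed

lemma linear_mult_vec: "linear (\<lambda>v. X *v v)" for X :: "'a::star_div_algebra ^ 'n ^ 'm"
  by (rule linearI) (simp_all add: matrix_vector_mult_def vec_eq_iff distrib_left
      sum.distrib scaleR_sum_right)

text \<open>Over a skew field there are no determinants; instead both matrices are viewed as real-linear maps of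
  a finite-dimensional real space.\<close>

lemma matrix_right_inverse_left:
  fixes A B :: "'a::star_euclidean ^ 'n ^ 'n"
  assumes "A ** B = mat 1"
  shows "B ** A = mat 1"
proof -
  have AB: "A *v (B *v v) = v" for v by (simp add: matrix_vector_mul_assoc assms)
  then have "inj (\<lambda>v. B *v v)" by (metis injI)
  then have "surj (\<lambda>v. B *v v)" by (rule linear_injective_imp_surjective[OF linear_mult_vec]) simp
  then have "(B ** A) *v v = mat 1 *v v" for v
    by (metis AB matrix_vector_mul_assoc matrix_vector_mul_lid surjE)
  then show ?thesis by (simp add: matrix_eq)
qed

text \<open>At a maximum \<open>v\<close> of the Rayleigh quotient on \<open>W\<close>, the form \<open>q\<close> belonging to \<open>\<mu> - L\<close> is nonnegative on \<open>W\<close>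
  and vanishes at \<open>v\<close>. A nonzero residual \<open>r = \<mu> v - L v\<close> would be a direction in which \<open>q\<close> becomes
  negative.\<close>

lemma selfadjoint_eigenvector:
  fixes L :: "'b::euclidean_space \<Rightarrow> 'b"
  assumes "linear L" and sym: "\<And>v w. L v \<bullet> w = v \<bullet> L w"
    and W: "subspace W" "\<And>v. v \<in> W \<Longrightarrow> L v \<in> W" "w \<in> W" "w \<noteq> 0"
  shows "\<exists>v \<mu>. v \<in> W \<and> norm v = 1 \<and> L v = \<mu> *\<^sub>R v"
proof -
  interpret L: linear L by fact
  define K where "K = W \<inter> sphere 0 1"
  have "compact K"
    unfolding K_def by (intro closed_Int_compact closed_subspace W compact_sphere)
  moreover have "w /\<^sub>R norm w \<in> K" using W by (simp add: K_def subspace_scale)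
  moreover have "continuous_on K (\<lambda>v. v \<bullet> L v)"
    using assms(1) by (intro continuous_on_inner continuous_on_id linear_continuous_on)
      (simp add: linear_conv_bounded_linear)
  ultimately obtain v where v: "v \<in> K" "\<And>u. u \<in> K \<Longrightarrow> u \<bullet> L u \<le> v \<bullet> L v"
    using continuous_attains_sup[of K "\<lambda>v. v \<bullet> L v"] by blast
  define \<mu> where "\<mu> = v \<bullet> L v"
  define q where "q u = \<mu> * (u \<bullet> u) - u \<bullet> L u" for u
  have vW: "v \<in> W" "norm v = 1" "v \<bullet> v = 1" using v(1) by (auto simp: K_def norm_eq_1)
  have q: "0 \<le> q u" if "u \<in> W" for u
  proof (cases "u = 0")
    case False
    have "u /\<^sub>R norm u \<in> K" using that False W by (simp add: K_def subspace_scale)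
    from v(2)[OF this] have "(u \<bullet> L u) / (norm u)\<^sup>2 \<le> \<mu>"
      by (simp add: L.scaleR \<mu>_def power2_eq_square divide_inverse mult_ac)
    then show ?thesis using False by (simp add: q_def power2_norm_eq_inner divide_le_eq)
  qed (simp add: q_def)
  define r where "r = \<mu> *\<^sub>R v - L v"
  have rW: "r \<in> W" unfolding r_def using W vW by (intro subspace_diff subspace_scale) auto
  have "r = 0"
  proof (rule ccontr)
    assume "r \<noteq> 0"
    then have r: "0 < r \<bullet> r" by simp
    have expand: "q (v - t *\<^sub>R r) = t\<^sup>2 * q r - 2 * t * (r \<bullet> r)" for t
    proof -
      have e1: "v \<bullet> L r = r \<bullet> L v" by (metis sym inner_commute)
      have "r \<bullet> (\<mu> *\<^sub>R v - L v) = r \<bullet> r" by (simp only: r_def)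
      then have e2: "r \<bullet> L v = \<mu> * (r \<bullet> v) - r \<bullet> r" by (simp add: inner_diff_right)
      have "q (v - t *\<^sub>R r) = \<mu> * (v \<bullet> v - 2 * t * (r \<bullet> v) + t\<^sup>2 * (r \<bullet> r))
          - (v \<bullet> L v - t * (v \<bullet> L r) - t * (r \<bullet> L v) + t\<^sup>2 * (r \<bullet> L r))"
        by (simp add: q_def L.diff L.scaleR inner_diff_left inner_diff_right inner_commute[of v r]
            power2_eq_square algebra_simps)
      then show ?thesis
        unfolding e1 e2 vW(3) \<mu>_def[symmetric] by (simp add: q_def algebra_simps)
    qed
    \<comment> \<open>Any \<open>t > 0\<close> with \<open>t * q r < 2 * (r \<bullet> r)\<close> would do; adding 1 avoids a division by zero.\<close>
    define t where "t = (r \<bullet> r) / (q r + 1)"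
    have q1: "0 < q r + 1" using q[OF rW] by simp
    then have t: "0 < t" "t * (q r + 1) = r \<bullet> r" using r by (auto simp: t_def)
    have "0 \<le> q (v - t *\<^sub>R r)" using q W vW rW by (simp add: subspace_diff subspace_scale)
    also have "\<dots> = t * (t * q r - 2 * (t * (q r + 1)))"
      unfolding expand t(2) by (simp add: power2_eq_square algebra_simps)
    also have "\<dots> < 0"
    proof (rule mult_pos_neg[OF t(1)])
      have "0 \<le> t * q r" using t(1) q[OF rW] by simp
      then show "t * q r - 2 * (t * (q r + 1)) < 0"
        using t(1) unfolding distrib_left by simp
    qed
    finally show False by simp
  qed
  then have "L v = \<mu> *\<^sub>R v" by (simp add: r_def)
  with vW(1,2) show ?thesis by (intro exI conjI)
qed

text \<open>The family grows by one index at a time. The eigenvectors found so far have a nonzero vector in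
  their orthogonal complement as long as an index is left, and the complement is invariant under \<open>X\<close>.
  Orthogonality is required for \<open>hprod\<close>, not just for the real inner product, since only then is the
  matrix of eigenvectors unitary.\<close>

lemma hermitian_orthonormal_eigenvectors:
  fixes X :: "'a::star_euclidean ^ 'n ^ 'n" and S :: "'n set"
  assumes herm: "conj_transpose X = X"
  shows "\<exists>u d. (\<forall>i\<in>S. X *v u i = d i *\<^sub>R u i) \<and>
               (\<forall>i\<in>S. \<forall>j\<in>S. hprod (u i) (u j) = (if i = j then 1 else 0))"
proof (induction S rule: finite_induct[OF finite])
  case (2 k S)
  then obtain u d where eig: "\<And>i. i \<in> S \<Longrightarrow> X *v u i = d i *\<^sub>R u i"
    and orth: "\<And>i j. i \<in> S \<Longrightarrow> j \<in> S \<Longrightarrow> hprod (u i) (u j) = (if i = j then 1 else 0)"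
    by blast
  define W where "W = {v. \<forall>i\<in>S. hprod (u i) v = 0}"
  have W: "subspace W"
    by (auto simp: W_def subspace_def hprod_add_right hprod_scaleR_right) (simp add: hprod_def)
  have inv: "X *v v \<in> W" if "v \<in> W" for v
    using that by (auto simp: W_def hprod_conj_transpose herm eig hprod_scaleR_left)
  \<comment> \<open>\<open>W\<close> is the kernel of \<open>T\<close>, and the coordinate \<open>k\<close> of every value of \<open>T\<close> is zero.\<close>
  define T :: "'a ^ 'n \<Rightarrow> 'a ^ 'n" where "T v = (\<chi> i. if i \<in> S then hprod (u i) v else 0)" for v
  have T: "linear T"
    by (rule linearI) (auto simp: T_def vec_eq_iff hprod_add_right hprod_scaleR_right)
  have "axis k 1 \<noteq> T v" for v using 2 by (auto simp: T_def vec_eq_iff axis_def)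
  then have "\<not> surj T" by (metis surjD)
  then have "\<not> inj T" using linear_injective_imp_surjective[OF T] by blast
  then obtain w where w: "w \<noteq> 0" "T w = 0" using linear_injective_0[OF T] by blast
  have "w \<in> W" using w(2) by (auto simp: W_def T_def vec_eq_iff split: if_splits)
  then obtain v \<mu> where v: "v \<in> W" "norm v = 1" "X *v v = \<mu> *\<^sub>R v"
    using selfadjoint_eigenvector[OF linear_mult_vec[of X] _ W inv] w(1)
      inner_conj_transpose[of _ X, unfolded herm] by metis
  have orth': "hprod (u i) v = 0" "hprod v (u i) = 0" if "i \<in> S" for i
    using v(1) that bar_hprod[of "u i" v] by (auto simp: W_def)
  have self: "hprod v v = 1" using v(2) by (simp add: hprod_self)
  have "X *v (u(k := v)) i = (d(k := \<mu>)) i *\<^sub>R (u(k := v)) i" if "i \<in> insert k S" for i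
    using that eig v(3) by (cases "i = k") auto
  moreover have "hprod ((u(k := v)) i) ((u(k := v)) j) = (if i = j then 1 else 0)"
    if "i \<in> insert k S" "j \<in> insert k S" for i j
    using that orth self orth' 2(2) by (cases "i = k"; cases "j = k") auto
  ultimately show ?case by blast
qed simp

lemma conj_transpose_mult: "conj_transpose (X ** Y) = conj_transpose Y ** conj_transpose X"
  by (simp add: conj_transpose_def matrix_matrix_mult_def vec_eq_iff bar_sum bar_mult)

lemma conj_transpose_conj_transpose [simp]: "conj_transpose (conj_transpose X) = X"
  by (simp add: conj_transpose_def vec_eq_iff bar_bar)

lemma conj_transpose_real_diag [simp]: "conj_transpose (real_diag d) = real_diag d"
  by (simp add: conj_transpose_def real_diag_def vec_eq_iff)

lemma real_diag_mult_nth: "(real_diag d ** X) $ i $ j = d i *\<^sub>R (X $ i $ j)"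
  by (simp add: real_diag_def matrix_matrix_mult_def scaleR_conv_of_real mult_delta_left)

lemma mult_real_diag_nth: "(X ** real_diag d) $ i $ j = d j *\<^sub>R (X $ i $ j)"
proof -
  have "x * of_real r = r *\<^sub>R x" for x :: 'a and r by (simp add: of_real_def)
  then show ?thesis
    by (simp add: real_diag_def matrix_matrix_mult_def mult_delta_right)
qed

lemma real_diag_mult_real_diag: "real_diag d ** real_diag e = real_diag (\<lambda>i. d i * e i)"
  by (simp add: vec_eq_iff real_diag_mult_nth) (simp add: real_diag_def scaleR_conv_of_real)

lemma real_diag_1: "real_diag (\<lambda>_. 1) = mat 1"
  by (simp add: real_diag_def mat_def vec_eq_iff)

lemma hermitian_diagonalization:
  fixes X :: "'a::star_euclidean ^ 'n ^ 'n"
  assumes "conj_transpose X = X"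
  obtains U :: "'a ^ 'n ^ 'n" and d where "U ** conj_transpose U = mat 1" "X = U ** real_diag d ** conj_transpose U"
proof -
  obtain u :: "'n \<Rightarrow> 'a ^ 'n" and d where eig: "\<And>i. X *v u i = d i *\<^sub>R u i"
    and orth: "\<And>i j. hprod (u i) (u j) = (if i = j then 1 else 0)"
    using hermitian_orthonormal_eigenvectors[OF assms, of UNIV] by blast
  define U where "U = (\<chi> i j. u j $ i)"
  have "conj_transpose U ** U = mat 1"
    using orth by (simp add: vec_eq_iff conj_transpose_def U_def matrix_matrix_mult_def mat_def hprod_def)
  then have U: "U ** conj_transpose U = mat 1" by (rule matrix_right_inverse_left)
  have "(X ** U) $ i $ j = (U ** real_diag d) $ i $ j" for i j
    using arg_cong[OF eig[of j], of "\<lambda>v. v $ i"]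
    by (simp add: mult_real_diag_nth) (simp add: U_def matrix_matrix_mult_def matrix_vector_mult_def)
  then have "X ** U = U ** real_diag d" by (simp add: vec_eq_iff)
  then have "X = U ** real_diag d ** conj_transpose U"
    by (metis U matrix_mul_assoc matrix_mul_rid)
  with U show ?thesis by (rule that)
qed


section \<open>Positive definite matrices and their functional calculus\<close>

text \<open>For a Hermitian matrix the quadratic form is invariant under \<open>bar\<close> and so equals its real part.\<close>

lemma posdef_iff_inner:
  fixes X :: "'a::star_euclidean ^ 'n ^ 'n"
  shows "X \<in> posdef \<longleftrightarrow> conj_transpose X = X \<and> (\<forall>v. v \<noteq> 0 \<longrightarrow> 0 < v \<bullet> (X *v v))"
proof (cases "conj_transpose X = X")
  case True
  have form: "(\<Sum>i\<in>UNIV. \<Sum>j\<in>UNIV. bar (v $ i) * X $ i $ j * v $ j) = of_real (v \<bullet> (X *v v))" for v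
  proof -
    have "hprod v (X *v v) = of_real (v \<bullet> (X *v v))"
      by (rule hprod_symmetric_real) (simp add: hprod_conj_transpose True)
    then show ?thesis
      by (simp add: hprod_def matrix_vector_mult_def sum_distrib_left mult.assoc)
  qed
  then show ?thesis using True by (auto simp: posdef_def)
qed (simp add: posdef_def)

lemma posdef_congruence:
  fixes X S :: "'a::star_euclidean ^ 'n ^ 'n"
  assumes X: "X \<in> posdef" and inv: "T ** S = mat 1"
  shows "conj_transpose S ** X ** S \<in> posdef"
  unfolding posdef_iff_inner
proof (intro conjI allI impI)
  show "conj_transpose (conj_transpose S ** X ** S) = conj_transpose S ** X ** S"
    using X by (simp add: posdef_iff_inner conj_transpose_mult matrix_mul_assoc)
  fix v :: "'a ^ 'n" assume "v \<noteq> 0"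
  moreover have "T *v (S *v v) = v" by (simp add: matrix_vector_mul_assoc inv)
  ultimately have "S *v v \<noteq> 0" by (metis linear_0 linear_mult_vec)
  then have "0 < (S *v v) \<bullet> (X *v (S *v v))" using X by (simp add: posdef_iff_inner)
  also have "\<dots> = v \<bullet> ((conj_transpose S ** X ** S) *v v)"
    by (simp add: inner_conj_transpose matrix_vector_mul_assoc[symmetric])
  finally show "0 < v \<bullet> ((conj_transpose S ** X ** S) *v v)" .
qed

lemma mult_vec_axis_nth: "(X *v axis i 1) $ k = X $ k $ i"
  by (simp add: matrix_vector_mult_def axis_def mult_delta_right)

lemma posdef_diag_entry:
  fixes X :: "'a::star_euclidean ^ 'n ^ 'n"
  assumes "X \<in> posdef"
  shows "0 < 1 \<bullet> (X $ i $ i)"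
proof -
  have "axis i (1::'a) \<noteq> 0" by simp
  then have "0 < axis i (1::'a) \<bullet> (X *v axis i 1)" using assms unfolding posdef_iff_inner by blast
  then show ?thesis by (simp only: inner_axis' mult_vec_axis_nth)
qed

lemma real_diag_posdef:
  assumes "\<And>i. 0 < d i"
  shows "(real_diag d :: 'a::star_euclidean ^ 'n ^ 'n) \<in> posdef"
  unfolding posdef_iff_inner
proof (intro conjI allI impI)
  fix v :: "'a ^ 'n" assume "v \<noteq> 0"
  then obtain k where k: "v $ k \<noteq> 0" by (auto simp: vec_eq_iff)
  have "real_diag d *v v = (\<chi> i. d i *\<^sub>R v $ i)"
    by (simp add: real_diag_def matrix_vector_mult_def vec_eq_iff scaleR_conv_of_real
        mult_delta_left)
  then have "v \<bullet> (real_diag d *v v) = (\<Sum>i\<in>UNIV. d i * (v $ i \<bullet> v $ i))"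
    by (simp add: inner_vec_def)
  also have "\<dots> > 0"
    using assms k by (intro sum_pos2[of _ k]) (auto intro!: mult_nonneg_nonneg less_imp_le[OF assms])
  finally show "0 < v \<bullet> (real_diag d *v v)" .
qed simp

lemma unitary_posdef:
  fixes U :: "'a::star_euclidean ^ 'n ^ 'n"
  assumes "U ** conj_transpose U = mat 1" "\<And>i. 0 < d i"
  shows "U ** real_diag d ** conj_transpose U \<in> posdef"
  using posdef_congruence[OF real_diag_posdef, of d U "conj_transpose U"] assms by simp

lemma posdef_diagonalization:
  fixes X :: "'a::star_euclidean ^ 'n ^ 'n"
  assumes "X \<in> posdef"
  obtains U :: "'a ^ 'n ^ 'n" and d where "U ** conj_transpose U = mat 1" "\<And>i. 0 < d i"
    "X = U ** real_diag d ** conj_transpose U"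
proof -
  obtain U :: "'a ^ 'n ^ 'n" and d where U: "U ** conj_transpose U = mat 1" "X = U ** real_diag d ** conj_transpose U"
    using hermitian_diagonalization assms by (metis posdef_iff_inner)
  have U': "conj_transpose U ** U = mat 1" using U(1) by (rule matrix_right_inverse_left)
  have "conj_transpose U ** X ** U = real_diag d"
    by (metis U(2) U' matrix_mul_assoc matrix_mul_lid matrix_mul_rid)
  then have D: "(real_diag d :: 'a ^ 'n ^ 'n) \<in> posdef"
    using posdef_congruence[OF assms U'] by simp
  have "0 < d i" for i
  proof -
    have "0 < d i * (1 \<bullet> (1::'a))"
      using posdef_diag_entry[OF D, of i] by (simp add: real_diag_def of_real_def)
    then show ?thesis by (rule zero_less_mult_pos2) simp
  qed
  with U that show ?thesis by blast
qed

text \<open>The entries of \<open>W = V\<^sup>* U\<close> satisfy \<open>W\<^sub>i\<^sub>j d\<^sub>j = e\<^sub>i W\<^sub>i\<^sub>j\<close>, so \<open>W\<close> only links equal eigenvalues and intertwines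
  the diagonal matrices of the values of \<open>g\<close> as well.\<close>

lemma functional_calculus_unique:
  fixes U V :: "'a::star_euclidean ^ 'n ^ 'n"
  assumes U: "U ** conj_transpose U = mat 1" and V: "V ** conj_transpose V = mat 1"
    and eq: "U ** real_diag d ** conj_transpose U = V ** real_diag e ** conj_transpose V"
  shows "U ** real_diag (\<lambda>i. g (d i)) ** conj_transpose U
       = V ** real_diag (\<lambda>i. g (e i)) ** conj_transpose V"
proof -
  note U' = matrix_right_inverse_left[OF U] and V' = matrix_right_inverse_left[OF V]
  define W where "W = conj_transpose V ** U"
  have "W ** real_diag d = conj_transpose V ** (U ** real_diag d ** conj_transpose U) ** U"
    by (metis W_def U' matrix_mul_assoc matrix_mul_rid)
  also have "\<dots> = real_diag e ** W"
    by (metis eq W_def V' matrix_mul_assoc matrix_mul_lid)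
  finally have "d j *\<^sub>R (W $ i $ j) = e i *\<^sub>R (W $ i $ j)" for i j
    by (metis mult_real_diag_nth real_diag_mult_nth)
  then have "W ** real_diag (\<lambda>i. g (d i)) = real_diag (\<lambda>i. g (e i)) ** W"
    by (simp add: vec_eq_iff mult_real_diag_nth real_diag_mult_nth) metis
  then have "V ** (W ** real_diag (\<lambda>i. g (d i))) ** conj_transpose U
      = V ** (real_diag (\<lambda>i. g (e i)) ** W) ** conj_transpose U" by simp
  moreover have "V ** W = U" by (metis V W_def matrix_mul_assoc matrix_mul_lid)
  moreover have "W ** conj_transpose U = conj_transpose V"
    by (metis U W_def matrix_mul_assoc matrix_mul_rid)
  ultimately show ?thesis by (metis matrix_mul_assoc)
qed

lemma fun_calc_diagonalized:
  fixes U :: "'a::star_euclidean ^ 'n ^ 'n"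
  assumes "U ** conj_transpose U = mat 1" "\<And>i. 0 < d i"
  shows "fun_calc g (U ** real_diag d ** conj_transpose U)
       = U ** real_diag (\<lambda>i. g (d i)) ** conj_transpose U"
  unfolding fun_calc_def
proof (rule the_equality)
  let ?Y = "U ** real_diag (\<lambda>i. g (d i)) ** conj_transpose U"
  show "\<exists>(V :: 'a ^ 'n ^ 'n) e. V ** conj_transpose V = mat 1 \<and> (\<forall>i. 0 < e i) \<and>
      U ** real_diag d ** conj_transpose U = V ** real_diag e ** conj_transpose V \<and>
      ?Y = V ** real_diag (\<lambda>i. g (e i)) ** conj_transpose V"
    using assms by (intro exI[of _ U] exI[of _ d] conjI allI refl)
  fix Y :: "'a ^ 'n ^ 'n"
  assume "\<exists>(V :: 'a ^ 'n ^ 'n) e. V ** conj_transpose V = mat 1 \<and> (\<forall>i. 0 < e i) \<and>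
      U ** real_diag d ** conj_transpose U = V ** real_diag e ** conj_transpose V \<and>
      Y = V ** real_diag (\<lambda>i. g (e i)) ** conj_transpose V"
  then obtain V :: "'a ^ 'n ^ 'n" and e where V: "V ** conj_transpose V = mat 1"
      "U ** real_diag d ** conj_transpose U = V ** real_diag e ** conj_transpose V"
      "Y = V ** real_diag (\<lambda>i. g (e i)) ** conj_transpose V"
    by (elim exE conjE) (rule that)
  show "Y = ?Y" unfolding V(3) by (rule functional_calculus_unique[OF assms(1) V(1,2), symmetric])
qed

lemma mat_powr_posdef:
  fixes X :: "'a::star_euclidean ^ 'n ^ 'n"
  assumes "X \<in> posdef"
  shows "mat_powr X t \<in> posdef"
proof -
  obtain U :: "'a ^ 'n ^ 'n" and d where U: "U ** conj_transpose U = mat 1" "\<And>i. 0 < d i"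
    "X = U ** real_diag d ** conj_transpose U"
    using posdef_diagonalization[OF assms] by blast
  have "0 < d i powr t" for i using U(2)[of i] by simp
  then show ?thesis
    unfolding mat_powr_def U(3) fun_calc_diagonalized[OF U(1,2)] by (rule unitary_posdef[OF U(1)])
qed

lemma mat_powr_add:
  fixes X :: "'a::star_euclidean ^ 'n ^ 'n"
  assumes "X \<in> posdef"
  shows "mat_powr X s ** mat_powr X t = mat_powr X (s + t)"
proof -
  obtain U :: "'a ^ 'n ^ 'n" and d where U: "U ** conj_transpose U = mat 1" "\<And>i. 0 < d i"
    "X = U ** real_diag d ** conj_transpose U"
    using posdef_diagonalization[OF assms] by blast
  have "mat_powr X s ** mat_powr X t
      = U ** (real_diag (\<lambda>i. d i powr s) ** (conj_transpose U ** U) ** real_diag (\<lambda>i. d i powr t)) ** conj_transpose U"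
    unfolding mat_powr_def U(3) fun_calc_diagonalized[OF U(1,2)] by (simp add: matrix_mul_assoc)
  also have "\<dots> = mat_powr X (s + t)"
    unfolding mat_powr_def U(3) fun_calc_diagonalized[OF U(1,2)] matrix_right_inverse_left[OF U(1)]
    by (simp add: real_diag_mult_real_diag powr_add)
  finally show ?thesis .
qed

lemma mat_powr_0:
  fixes X :: "'a::star_euclidean ^ 'n ^ 'n"
  assumes "X \<in> posdef"
  shows "mat_powr X 0 = mat 1"
proof -
  obtain U :: "'a ^ 'n ^ 'n" and d where U: "U ** conj_transpose U = mat 1" "\<And>i. 0 < d i"
    "X = U ** real_diag d ** conj_transpose U"
    using posdef_diagonalization[OF assms] by blast
  have "d i \<noteq> 0" for i using U(2)[of i] by simp
  then show ?thesis
    unfolding mat_powr_def U(3) fun_calc_diagonalized[OF U(1,2)] by (simp add: real_diag_1 U(1))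
qed

lemma mat_powr_1:
  fixes X :: "'a::star_euclidean ^ 'n ^ 'n"
  assumes "X \<in> posdef"
  shows "mat_powr X 1 = X"
proof -
  obtain U :: "'a ^ 'n ^ 'n" and d where U: "U ** conj_transpose U = mat 1" "\<And>i. 0 < d i"
    "X = U ** real_diag d ** conj_transpose U"
    using posdef_diagonalization[OF assms] by blast
  have "d i powr 1 = d i" for i using U(2)[of i] by simp
  then show ?thesis unfolding mat_powr_def U(3) fun_calc_diagonalized[OF U(1,2)] by simp
qed

lemma Spec_diagonalized_subset:
  fixes U :: "'a::star_euclidean ^ 'n ^ 'n"
  assumes U: "U ** conj_transpose U = mat 1"
  shows "Spec (U ** real_diag d ** conj_transpose U) \<subseteq> of_real ` range d"
proof
  fix l assume "l \<in> Spec (U ** real_diag d ** conj_transpose U)"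
  then obtain v where v: "v \<noteq> 0" "(U ** real_diag d ** conj_transpose U) *v v = (\<chi> i. v $ i * l)"
    by (auto simp: Spec_def)
  define w where "w = conj_transpose U *v v"
  have "U *v w = v" by (simp add: w_def matrix_vector_mul_assoc U)
  then have "w \<noteq> 0" using v(1) by (metis linear_0 linear_mult_vec)
  then obtain i where i: "w $ i \<noteq> 0" by (auto simp: vec_eq_iff)
  have "conj_transpose U *v (\<chi> i. v $ i * l) = (\<chi> i. w $ i * l)"
    by (simp add: w_def matrix_vector_mult_def vec_eq_iff sum_distrib_right mult.assoc)
  moreover have "conj_transpose U *v ((U ** real_diag d ** conj_transpose U) *v v) = real_diag d *v w"
    using matrix_right_inverse_left[OF U] unfolding w_def
    by (metis matrix_vector_mul_assoc matrix_vector_mul_lid)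
  ultimately have "real_diag d *v w = (\<chi> i. w $ i * l)" using v(2) by simp
  then have "(real_diag d *v w) $ i = w $ i * l" by simp
  moreover have "(real_diag d *v w) $ i = w $ i * of_real (d i)"
    by (simp add: real_diag_def matrix_vector_mult_def mult_delta_left of_real_def)
  ultimately have "l = of_real (d i)" using i by simp
  then show "l \<in> of_real ` range d" by simp
qed


section \<open>Linearizable alternative means\<close>

lemma matrix_inv_posdef:
  fixes A :: "'a::star_euclidean ^ 'n ^ 'n"
  assumes "A \<in> posdef"
  shows "matrix_inv A = mat_powr A (-1)"
proof -
  have "A ** mat_powr A (-1) = mat 1" "mat_powr A (-1) ** A = mat 1"
    using mat_powr_add[OF assms, of 1 "-1"] mat_powr_add[OF assms, of "-1" 1]
    by (simp_all add: mat_powr_0 mat_powr_1 assms)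
  moreover from this have "A ** matrix_inv A = mat 1 \<and> matrix_inv A ** A = mat 1"
    unfolding matrix_inv_def by (intro someI_ex[of "\<lambda>Y. A ** Y = mat 1 \<and> Y ** A = mat 1"]) blast
  ultimately show ?thesis by (metis matrix_mul_assoc matrix_mul_lid matrix_mul_rid)
qed

text \<open>With \<open>P = A\<^sup>-\<^sup>1\<close>, \<open>Q = P\<^sup>1\<^sup>/\<^sup>2\<close>, \<open>R = Q\<^sup>-\<^sup>1\<close> and \<open>H = (R B R)\<^sup>1\<^sup>/\<^sup>2\<close> one has \<open>C = Q H Q\<close> and \<open>Q A Q = 1\<close>, so the
  product \<open>C A C\<close> collapses to \<open>Q H\<^sup>2 Q = B\<close>.\<close>

lemma geo_mean_riccati:
  fixes A B :: "'a::star_euclidean ^ 'n ^ 'n"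
  assumes A: "A \<in> posdef" and B: "B \<in> posdef"
  defines "C \<equiv> geo_mean (matrix_inv A) B"
  shows "C \<in> posdef" and "C ** A ** C = B"
proof -
  define P where "P = matrix_inv A"
  have P: "P \<in> posdef" unfolding P_def matrix_inv_posdef[OF A] by (rule mat_powr_posdef[OF A])
  have "A ** P = mat 1"
    using mat_powr_add[OF A, of 1 "-1"]
    by (simp add: mat_powr_0 mat_powr_1 A P_def matrix_inv_posdef)
  define Q R where "Q = mat_powr P (1/2)" and "R = mat_powr P (-1/2)"
  have Q: "Q \<in> posdef" and R: "R \<in> posdef"
    unfolding Q_def R_def by (rule mat_powr_posdef[OF P])+
  have QQ: "Q ** Q = P" and QR: "Q ** R = mat 1" and RQ: "R ** Q = mat 1"
    by (simp_all add: Q_def R_def mat_powr_add P mat_powr_0 mat_powr_1)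
  have herm: "conj_transpose Q = Q" "conj_transpose R = R"
    using Q R by (auto simp: posdef_iff_inner)
  have M: "R ** B ** R \<in> posdef" using posdef_congruence[OF B QR] by (simp add: herm)
  define H where "H = mat_powr (R ** B ** R) (1/2)"
  have H: "H \<in> posdef" unfolding H_def by (rule mat_powr_posdef[OF M])
  have HH: "H ** H = R ** B ** R" by (simp add: H_def mat_powr_add M mat_powr_1)
  have C: "C = Q ** H ** Q" by (simp add: C_def geo_mean_def H_def Q_def R_def P_def)
  show "C \<in> posdef" unfolding C using posdef_congruence[OF H RQ] by (simp add: herm)
  have QAQ: "Q ** A ** Q = mat 1"
  proof -
    have "(Q ** A) ** Q = mat 1 \<longleftrightarrow> Q ** (Q ** A) = mat 1"
      using matrix_right_inverse_left by blast
    also have "Q ** (Q ** A) = P ** A" by (simp add: matrix_mul_assoc QQ)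
    finally show ?thesis using matrix_right_inverse_left[OF \<open>A ** P = mat 1\<close>] by simp
  qed
  have "C ** A ** C = Q ** H ** (Q ** A ** Q) ** H ** Q" by (simp add: C matrix_mul_assoc)
  also have "\<dots> = Q ** (H ** H) ** Q" by (simp add: QAQ matrix_mul_assoc)
  also have "\<dots> = (Q ** R) ** B ** (R ** Q)" by (simp add: HH matrix_mul_assoc)
  finally show "C ** A ** C = B" by (simp add: QR RQ)
qed

lemma scaled_entry_eq:
  fixes x :: "'a::real_vector"
  shows "p *\<^sub>R x = a *\<^sub>R x + b *\<^sub>R (q *\<^sub>R x) \<Longrightarrow> x \<noteq> 0 \<Longrightarrow> p = a + b * q"
  by (metis scaleR_add_left scaleR_right_imp_eq scaleR_scaleR)

lemma linearizable_commute_spec: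
  fixes A B :: "'a::star_euclidean ^ 'n ^ 'n"
  assumes A: "A \<in> posdef" and B: "B \<in> posdef" and lin: "alt_mean_linearizable f A B"
    and pos: "\<And>x. 0 < x \<Longrightarrow> 0 < f x" and conc: "chord_concave (\<lambda>x. (f (sqrt x))\<^sup>2)"
  shows "A ** B = B ** A \<and> finite (Spec (geo_mean (matrix_inv A) B)) \<and>
    card (Spec (geo_mean (matrix_inv A) B)) \<le> 2"
proof -
  define C where "C = geo_mean (matrix_inv A) B"
  have C: "C \<in> posdef" "C ** A ** C = B"
    unfolding C_def using geo_mean_riccati[OF A B] by auto
  obtain U :: "'a ^ 'n ^ 'n" and c where U: "U ** conj_transpose U = mat 1" and c: "\<And>i. 0 < c i"
    and CU: "C = U ** real_diag c ** conj_transpose U"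
    using posdef_diagonalization[OF C(1)] by blast
  note U' = matrix_right_inverse_left[OF U]
  define A' where "A' = conj_transpose U ** A ** U"
  have A': "A' \<in> posdef" unfolding A'_def by (rule posdef_congruence[OF A U'])
  have conj: "conj_transpose U ** ((U ** real_diag d ** conj_transpose U) ** A **
        (U ** real_diag d ** conj_transpose U)) ** U
      = real_diag d ** A' ** real_diag d" for d
  proof -
    have "conj_transpose U ** ((U ** real_diag d ** conj_transpose U) ** A **
          (U ** real_diag d ** conj_transpose U)) ** U
        = (conj_transpose U ** U) ** real_diag d ** A' ** real_diag d ** (conj_transpose U ** U)"
      unfolding A'_def by (simp only: matrix_mul_assoc)
    then show ?thesis by (simp add: U')
  qed
  obtain a b where ab: "alt_mean f A B = a *\<^sub>R A + b *\<^sub>R B"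
    using lin by (auto simp: alt_mean_linearizable_def)
  have "alt_mean f A B = (U ** real_diag (\<lambda>i. f (c i)) ** conj_transpose U) ** A **
      (U ** real_diag (\<lambda>i. f (c i)) ** conj_transpose U)"
    unfolding alt_mean_def C_def[symmetric] CU fun_calc_diagonalized[OF U c] ..
  then have "real_diag (\<lambda>i. f (c i)) ** A' ** real_diag (\<lambda>i. f (c i))
      = conj_transpose U ** (a *\<^sub>R A + b *\<^sub>R B) ** U"
    using conj[of "\<lambda>i. f (c i)"] ab by simp
  also have "\<dots> = a *\<^sub>R A' + b *\<^sub>R (conj_transpose U ** B ** U)"
    by (simp add: A'_def matrix_matrix_mult_def vec_eq_iff distrib_left distrib_right
        sum.distrib scaleR_sum_right sum_distrib_right)
  also have "conj_transpose U ** B ** U = real_diag c ** A' ** real_diag c"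
    unfolding C(2)[symmetric] using conj[of c] CU by simp
  finally have "(f (c i) * f (c j)) *\<^sub>R A' $ i $ j
      = a *\<^sub>R A' $ i $ j + b *\<^sub>R ((c i * c j) *\<^sub>R A' $ i $ j)" for i j
    by (simp add: vec_eq_iff mult_real_diag_nth real_diag_mult_nth mult.commute)
  then have entry: "f (c i) * f (c j) = a + b * (c i * c j)" if "A' $ i $ j \<noteq> 0" for i j
    using scaled_entry_eq that by blast
  define g where "g x = (f (sqrt x))\<^sup>2" for x
  have g: "chord_concave g" "\<And>x. 0 < x \<Longrightarrow> 0 < g x"
    using conc by (simp add: g_def[abs_def]) (simp only: g_def zero_less_power pos real_sqrt_gt_zero)
  have f_diag: "(f (c i))\<^sup>2 = a + b * (c i)\<^sup>2" for i
  proof -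
    have "A' $ i $ i \<noteq> 0" using posdef_diag_entry[OF A', of i] by auto
    from entry[OF this] show ?thesis by (simp only: power2_eq_square)
  qed
  then have diag: "g ((c i)\<^sup>2) = a + b * (c i)\<^sup>2" for i
    using c[of i] by (simp add: g_def)
  have offdiag: "c i = c j" if "A' $ i $ j \<noteq> 0" for i j
  proof (rule ccontr)
    assume ne: "c i \<noteq> c j"
    have "(a + b * (c i * c j))\<^sup>2 = (a + b * (c i)\<^sup>2) * (a + b * (c j)\<^sup>2)"
      by (simp only: power_mult_distrib flip: entry[OF that] f_diag)
    then have "a * b * (c i - c j)\<^sup>2 = 0" by (simp add: power2_eq_square algebra_simps)
    then have "a = 0 \<or> b = 0" using ne by simp
    moreover have no: False if "c k < c l" "a = 0 \<or> b = 0" for k l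
    proof -
      have "(c k)\<^sup>2 < (c l)\<^sup>2" "0 < (c k)\<^sup>2"
        using that c[of k] c[of l] by (auto intro: power_strict_mono)
      then show False
        using chord_concave_eq_linear[OF g, of "(c k)\<^sup>2" "(c l)\<^sup>2" b]
          chord_concave_eq_const[OF g, of "(c k)\<^sup>2" "(c l)\<^sup>2" a] diag[of k] diag[of l] that(2)
        by auto
    qed
    ultimately show False using ne by (metis linorder_neqE)
  qed
  have "real_diag c ** A' = A' ** real_diag c"
    using offdiag by (auto simp: vec_eq_iff mult_real_diag_nth real_diag_mult_nth)
  then have "U ** (real_diag c ** A') ** conj_transpose U = U ** (A' ** real_diag c) ** conj_transpose U"
    by simp
  moreover have "U ** A' = A ** U" "A' ** conj_transpose U = conj_transpose U ** A"
    unfolding A'_def by (metis U matrix_mul_assoc matrix_mul_lid matrix_mul_rid)+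
  ultimately have "C ** A = A ** C" unfolding CU by (metis matrix_mul_assoc)
  then have AB: "A ** B = B ** A" by (metis C(2) matrix_mul_assoc)
  have "card ((\<lambda>i. (c i)\<^sup>2) ` UNIV) \<le> 2"
  proof (rule chord_concave_affine_card[OF g(1)])
    show "0 < x \<and> g x = a + b * x" if "x \<in> range (\<lambda>i. (c i)\<^sup>2)" for x
      using that c diag by (auto simp: less_imp_neq[symmetric])
  qed simp
  moreover have "card (range c) = card ((\<lambda>x. x\<^sup>2) ` range c)"
    using c by (intro card_image[symmetric] inj_onI) (auto simp: power2_eq_iff_nonneg less_imp_le)
  ultimately have card: "card (range c) \<le> 2" by (simp add: image_image)
  have sub: "Spec C \<subseteq> of_real ` range c" unfolding CU by (rule Spec_diagonalized_subset[OF U])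
  have "card (Spec C) \<le> card (range c)"
    using card_mono[OF _ sub] card_image_le[of "range c" "of_real :: real \<Rightarrow> 'a"] by simp
  then show ?thesis using AB card finite_subset[OF sub] by (simp add: C_def)
qed

text \<open>The substitution of \<open>sqrt x\<close> is the one suggested by \<open>f(c)\<^sup>2 = a + b c\<^sup>2\<close>, which becomes affine in
  \<open>x = c\<^sup>2\<close>.\<close>

lemma mean_functions_chord_concave:
  fixes f :: "real \<Rightarrow> real"
  assumes "(\<forall>x>0. f x = sqrt (2 * x / (1 + x))) \<or>
           (\<forall>x>0. f x = (if x = 1 then 1 else sqrt ((x - 1) / ln x))) \<or>
           (\<exists>\<alpha>::real. 0 < \<alpha> \<and> \<alpha> < 1 \<and> (\<forall>x>0. f x = x powr (\<alpha> / 2)))"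
  shows "(\<forall>x>0. 0 < f x) \<and> chord_concave (\<lambda>x. (f (sqrt x))\<^sup>2)"
proof -
  have cong: "chord_concave g \<Longrightarrow> (\<And>x. 0 < x \<Longrightarrow> h x = g x) \<Longrightarrow> chord_concave h" for g h
    by (simp add: chord_concave_def)
  consider (1) "\<forall>x>0. f x = sqrt (2 * x / (1 + x))"
    | (2) "\<forall>x>0. f x = (if x = 1 then 1 else sqrt ((x - 1) / ln x))"
    | (3) \<alpha> where "0 < \<alpha>" "\<alpha> < 1" "\<forall>x>0. f x = x powr (\<alpha> / 2)"
    using assms by blast
  then show ?thesis
  proof cases
    case 1
    then show ?thesis by (auto intro!: cong[OF chord_concave_harmonic])
  next
    case 2
    have pos: "0 < (x - 1) / ln x" if "0 < x" "x \<noteq> 1" for x :: real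
      using that by (cases "x < 1") (auto intro: divide_neg_neg)
    have "(f (sqrt x))\<^sup>2 = (if x = 1 then 1 else (sqrt x - 1) / ln (sqrt x))" if "0 < x" for x
      using that 2 pos[of "sqrt x"] by (auto simp del: ln_sqrt)
    then show ?thesis using 2 pos by (auto intro!: cong[OF chord_concave_logarithmic])
  next
    case 3
    have "(f (sqrt x))\<^sup>2 = x powr (\<alpha> / 2)" if "0 < x" for x
      using that 3(3) by (simp add: powr_half_sqrt[symmetric] powr_powr power2_eq_square flip: powr_add)
    then show ?thesis using 3 by (auto intro!: cong[OF chord_concave_powr[of "\<alpha> / 2"]])
  qed
qed

theorem mainTheorem4:
  fixes f :: "real \<Rightarrow> real"
  assumes "(\<forall>x>0. f x = sqrt (2 * x / (1 + x))) \<or>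
           (\<forall>x>0. f x = (if x = 1 then 1 else sqrt ((x - 1) / ln x))) \<or>
           (\<exists>\<alpha>::real. 0 < \<alpha> \<and> \<alpha> < 1 \<and> (\<forall>x>0. f x = x powr (\<alpha> / 2)))"
  shows "(\<forall>A B :: real ^ 'n ^ 'n. A \<in> posdef \<and> B \<in> posdef \<and> alt_mean_linearizable f A B \<longrightarrow>
           A ** B = B ** A \<and>
           finite (Spec (geo_mean (matrix_inv A) B)) \<and>
           card (Spec (geo_mean (matrix_inv A) B)) \<le> 2) \<and>
         (\<forall>A B :: complex ^ 'n ^ 'n. A \<in> posdef \<and> B \<in> posdef \<and> alt_mean_linearizable f A B \<longrightarrow>
           A ** B = B ** A \<and>
           finite (Spec (geo_mean (matrix_inv A) B)) \<and>
           card (Spec (geo_mean (matrix_inv A) B)) \<le> 2) \<and>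
         (\<forall>A B :: quat ^ 'n ^ 'n. A \<in> posdef \<and> B \<in> posdef \<and> alt_mean_linearizable f A B \<longrightarrow>
           A ** B = B ** A \<and>
           finite (Spec (geo_mean (matrix_inv A) B)) \<and>
           card (Spec (geo_mean (matrix_inv A) B)) \<le> 2)"
proof -
  have pos: "\<And>x. 0 < x \<Longrightarrow> 0 < f x" and conc: "chord_concave (\<lambda>x. (f (sqrt x))\<^sup>2)"
    using mean_functions_chord_concave[OF assms] by auto
  note main = linearizable_commute_spec[OF _ _ _ pos conc]
  show ?thesis
    by (intro conjI allI impI; elim conjE;
        rule main[THEN conjunct1] main[THEN conjunct2, THEN conjunct1] main[THEN conjunct2, THEN conjunct2];
        assumption)
qed

end
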